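(* Let $G$ be a finite-dimensional Lie group, $\mathbb L:G\times G\to\mathbb R$ a smooth function with $\mathbb L(g_1\bar g,g_2\bar g)=\mathbb L(g_1,g_2)$ for all $g_1,g_2,\bar g\in G$, and $\ell:G\to\mathbb R$ the reduced discrete Lagrangian defined by $\ell(g_1g_2^{-1})=\mathbb L(g_1,g_2)$. The discrete Euler-Lagrange (DEL) algorithm governed by $\mathbb L$ and the discrete Euler-Poincaré (DEP) algorithm governed by $\ell$ are related as follows. (i) The canonical projection of a solution of DEL gives a solution of DEP: if $(g_k)$ satisfies the DEL equations, then $f_{k\,k+1}=\pi(g_k,g_{k+1})=g_kg_{k+1}^{-1}$ satisfies the DEP equations. (ii) The reconstruction of a solution of the DEP equations results in a solution of the DEL equations: if $(f_{k\,k+1})$ satisfies the DEP equations, then for any initial $g_0\in G$ the sequence defined by $g_{k+1}=f_{k\,k+1}^{-1}\cdot g_k$, equivalently $$(g_{k-1},g_k)\mapsto(g_k,g_{k+1})=(f_{k-1\,k}^{-1}\cdot g_{k-1},\,f_{k\,k+1}^{-1}\cdot g_k),$$ satisfies the DEL equations.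
   Context: The DEL equations are, for each interior index $k$, $D_2\mathbb L(g_{k-1},g_k)+D_1\mathbb L(g_k,g_{k+1})=0$ in $T^*_{g_k}G$, where $D_1,D_2$ are the partial differentials. The DEP equations are, for each interior index $k$ and all $\vartheta\in\mathfrak g$, $$-\ell'(f_{k-1\,k})\cdot TR_{f_{k-1\,k}}\bigl(\operatorname{Ad}_{f_{k-1\,k}}\vartheta\bigr)+\ell'(f_{k\,k+1})\cdot TR_{f_{k\,k+1}}(\vartheta)=0,$$ where $\ell'$ is the differential of $\ell$, $TR_f:\mathfrak g\to T_fG$ is the tangent map at $e$ of right translation $R_f(g)=gf$, and $\operatorname{Ad}$ is the adjoint action. Canonical projection: $\pi:G\times G\to(G\times G)/G\cong G$, $\pi(g_1,g_2)=g_1g_2^{-1}$, the quotient by the diagonal right action. *)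

theory Defs
  imports "HOL-Analysis.Analysis" "HOL-Algebra.Group"
begin

subsection \<open>Smooth maps between open subsets of model spaces\<close>

text \<open>
  Iterated directional derivatives. For an open set \<open>S\<close> in a finite-dimensional space this is the
  usual notion of a map of class \<open>C\<^sup>k\<close> on \<open>S\<close>.
\<close>

primrec Ck_on :: "nat \<Rightarrow> 'e::real_normed_vector set \<Rightarrow> ('e \<Rightarrow> 'f::real_normed_vector) \<Rightarrow> bool" where
  "Ck_on 0 S f \<longleftrightarrow> continuous_on S f"
| "Ck_on (Suc k) S f \<longleftrightarrow>
     (\<forall>x\<in>S. f differentiable (at x)) \<and> (\<forall>v. Ck_on k S (\<lambda>x. frechet_derivative f (at x) v))"

definition smooth_on :: "'e::real_normed_vector set \<Rightarrow> ('e \<Rightarrow> 'f::real_normed_vector) \<Rightarrow> bool" where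
  "smooth_on S f \<longleftrightarrow> (\<forall>k. Ck_on k S f)"


subsection \<open>Smooth manifolds\<close>

text \<open>
  A chart is a pair of a domain and a coordinate map; only the values of the coordinate map on the
  domain are relevant. The atlas need not be maximal.
\<close>

record ('a, 'e) manifold =
  mtop :: "'a topology"
  atlas :: "('a set \<times> ('a \<Rightarrow> 'e)) set"

text \<open>
  The model space is a finite-dimensional inner product space. The class \<open>euclidean_space\<close> is not
  used for this purpose because it excludes dimension \<open>0\<close>, i.e. discrete groups.
\<close>

locale smooth_manifold =
  fixes M :: "('a, 'e::real_inner) manifold"
  assumes finite_dim: "\<exists>B::'e set. finite B \<and> span B = UNIV"
    and Hausdorff: "Hausdorff_space (mtop M)"
    and second_countable: "second_countable (mtop M)"
    and atlas_covers: "(\<Union>(U, \<phi>)\<in>atlas M. U) = topspace (mtop M)"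
    and chart_openin: "(U, \<phi>) \<in> atlas M \<Longrightarrow> openin (mtop M) U"
    and chart_open_image: "(U, \<phi>) \<in> atlas M \<Longrightarrow> open (\<phi> ` U)"
    and chart_homeomorphic: "(U, \<phi>) \<in> atlas M \<Longrightarrow>
           homeomorphic_map (subtopology (mtop M) U) (top_of_set (\<phi> ` U)) \<phi>"
    and smooth_transition: "(U, \<phi>) \<in> atlas M \<Longrightarrow> (V, \<psi>) \<in> atlas M \<Longrightarrow>
           smooth_on (\<phi> ` (U \<inter> V)) (\<psi> \<circ> inv_into U \<phi>)"

definition smooth_map ::
  "('a, 'e::real_normed_vector) manifold \<Rightarrow> ('b, 'f::real_normed_vector) manifold \<Rightarrow> ('a \<Rightarrow> 'b) \<Rightarrow> bool" where
  "smooth_map M N F \<longleftrightarrow> continuous_map (mtop M) (mtop N) F \<and>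
     (\<forall>(U, \<phi>)\<in>atlas M. \<forall>(V, \<psi>)\<in>atlas N.
        smooth_on (\<phi> ` (U \<inter> F -` V)) (\<psi> \<circ> F \<circ> inv_into U \<phi>))"

definition prod_manifold ::
  "('a, 'e) manifold \<Rightarrow> ('b, 'f) manifold \<Rightarrow> ('a \<times> 'b, 'e \<times> 'f) manifold" where
  "prod_manifold M N =
     \<lparr>mtop = prod_topology (mtop M) (mtop N),
      atlas = {(U \<times> V, map_prod \<phi> \<psi>) | U \<phi> V \<psi>. (U, \<phi>) \<in> atlas M \<and> (V, \<psi>) \<in> atlas N}\<rparr>"

definition open_submanifold :: "'e::topological_space set \<Rightarrow> ('e, 'e) manifold" where
  "open_submanifold S = \<lparr>mtop = top_of_set S, atlas = {(S, id)}\<rparr>"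

abbreviation smooth_function :: "('a, 'e::real_normed_vector) manifold \<Rightarrow> ('a \<Rightarrow> real) \<Rightarrow> bool" where
  "smooth_function M f \<equiv> smooth_map M (open_submanifold UNIV) f"


subsection \<open>Tangent vectors, tangent maps and differentials\<close>

text \<open>
  A curve through \<open>p\<close> only has to be smooth near \<open>0\<close>; its values outside of a neighbourhood of \<open>0\<close>
  are irrelevant.
\<close>

definition curve_at :: "('a, 'e::real_normed_vector) manifold \<Rightarrow> 'a \<Rightarrow> (real \<Rightarrow> 'a) \<Rightarrow> bool" where
  "curve_at M p \<gamma> \<longleftrightarrow>
     \<gamma> 0 = p \<and> (\<exists>\<epsilon>>0. smooth_map (open_submanifold {-\<epsilon><..<\<epsilon>}) M \<gamma>)"

definition same_velocity ::
  "('a, 'e::real_normed_vector) manifold \<Rightarrow> 'a \<Rightarrow> (real \<Rightarrow> 'a) \<Rightarrow> (real \<Rightarrow> 'a) \<Rightarrow> bool" where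
  "same_velocity M p \<gamma> \<delta> \<longleftrightarrow>
     (\<forall>(U, \<phi>)\<in>atlas M. p \<in> U \<longrightarrow>
        vector_derivative (\<phi> \<circ> \<gamma>) (at 0) = vector_derivative (\<phi> \<circ> \<delta>) (at 0))"

definition velocity ::
  "('a, 'e::real_normed_vector) manifold \<Rightarrow> 'a \<Rightarrow> (real \<Rightarrow> 'a) \<Rightarrow> (real \<Rightarrow> 'a) set" where
  "velocity M p \<gamma> = {\<delta>. curve_at M p \<delta> \<and> same_velocity M p \<gamma> \<delta>}"

definition tangent_space ::
  "('a, 'e::real_normed_vector) manifold \<Rightarrow> 'a \<Rightarrow> (real \<Rightarrow> 'a) set set" where
  "tangent_space M p = {velocity M p \<gamma> | \<gamma>. curve_at M p \<gamma>}"

text \<open>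
  \<open>T\<^sub>pF([\<gamma>]) = [F \<circ> \<gamma>]\<close>, where the classes \<open>[F \<circ> \<gamma>]\<close> agree for all representatives \<open>\<gamma>\<close>.
\<close>

definition tangent_map ::
  "('a, 'e::real_normed_vector) manifold \<Rightarrow> ('b, 'f::real_normed_vector) manifold \<Rightarrow>
   ('a \<Rightarrow> 'b) \<Rightarrow> 'a \<Rightarrow> (real \<Rightarrow> 'a) set \<Rightarrow> (real \<Rightarrow> 'b) set" where
  "tangent_map M N F p \<xi> = (\<Union>\<gamma>\<in>\<xi>. velocity N (F p) (F \<circ> \<gamma>))"

text \<open>
  The differential of a real-valued function at \<open>p\<close> as an element of the dual of the tangent space:
  it maps \<open>[\<gamma>]\<close> to the derivative of \<open>f \<circ> \<gamma>\<close> at \<open>0\<close>.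
\<close>

definition differential ::
  "('a, 'e::real_normed_vector) manifold \<Rightarrow> ('a \<Rightarrow> real) \<Rightarrow> 'a \<Rightarrow> (real \<Rightarrow> 'a) set \<Rightarrow> real" where
  "differential M f p =
     (\<lambda>\<xi>\<in>tangent_space M p. THE d. \<forall>\<gamma>\<in>\<xi>. ((f \<circ> \<gamma>) has_real_derivative d) (at 0))"

definition D1 ::
  "('a, 'e::real_normed_vector) manifold \<Rightarrow> ('a \<times> 'a \<Rightarrow> real) \<Rightarrow> 'a \<Rightarrow> 'a \<Rightarrow> (real \<Rightarrow> 'a) set \<Rightarrow> real" where
  "D1 M L g h = differential M (\<lambda>x. L (x, h)) g"

definition D2 ::
  "('a, 'e::real_normed_vector) manifold \<Rightarrow> ('a \<times> 'a \<Rightarrow> real) \<Rightarrow> 'a \<Rightarrow> 'a \<Rightarrow> (real \<Rightarrow> 'a) set \<Rightarrow> real" where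
  "D2 M L g h = differential M (\<lambda>x. L (g, x)) h"


subsection \<open>Lie groups\<close>

locale lie_group = group G + smooth_manifold M
  for G :: "'a monoid" (structure) and M :: "('a, 'e::real_inner) manifold" +
  assumes topspace_carrier: "topspace (mtop M) = carrier G"
    and smooth_mult: "smooth_map (prod_manifold M M) M (\<lambda>(x, y). x \<otimes> y)"
    and smooth_inv: "smooth_map M M (\<lambda>x. inv x)"

abbreviation lie_algebra ::
  "'a monoid \<Rightarrow> ('a, 'e::real_normed_vector) manifold \<Rightarrow> (real \<Rightarrow> 'a) set set" where
  "lie_algebra G M \<equiv> tangent_space M \<one>\<^bsub>G\<^esub>"

definition TR ::
  "'a monoid \<Rightarrow> ('a, 'e::real_normed_vector) manifold \<Rightarrow> 'a \<Rightarrow> (real \<Rightarrow> 'a) set \<Rightarrow> (real \<Rightarrow> 'a) set" where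
  "TR G M f = tangent_map M M (\<lambda>g. g \<otimes>\<^bsub>G\<^esub> f) \<one>\<^bsub>G\<^esub>"

definition Ad ::
  "'a monoid \<Rightarrow> ('a, 'e::real_normed_vector) manifold \<Rightarrow> 'a \<Rightarrow> (real \<Rightarrow> 'a) set \<Rightarrow> (real \<Rightarrow> 'a) set" where
  "Ad G M f = tangent_map M M (\<lambda>g. f \<otimes>\<^bsub>G\<^esub> g \<otimes>\<^bsub>G\<^esub> inv\<^bsub>G\<^esub> f) \<one>\<^bsub>G\<^esub>"


subsection \<open>Discrete Euler-Lagrange and Euler-Poincare equations\<close>

text \<open>
  A discrete trajectory consists of \<open>g 0, \<dots>, g N\<close>; the interior indices are \<open>0 < k < N\<close>. Equality to
  zero in the cotangent space at \<open>g k\<close> is tested on all tangent vectors at \<open>g k\<close>.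
\<close>

definition DEL_solution ::
  "'a monoid \<Rightarrow> ('a, 'e::real_normed_vector) manifold \<Rightarrow> ('a \<times> 'a \<Rightarrow> real) \<Rightarrow> nat \<Rightarrow> (nat \<Rightarrow> 'a) \<Rightarrow> bool" where
  "DEL_solution G M L N g \<longleftrightarrow>
     (\<forall>k\<le>N. g k \<in> carrier G) \<and>
     (\<forall>k. 0 < k \<and> k < N \<longrightarrow>
        (\<forall>v\<in>tangent_space M (g k).
           D2 M L (g (k - 1)) (g k) v + D1 M L (g k) (g (k + 1)) v = 0))"

text \<open>In the following, \<open>f k\<close> stands for the group element \<open>f\<close> with double index \<open>k, k + 1\<close>.\<close>

definition DEP_solution ::
  "'a monoid \<Rightarrow> ('a, 'e::real_normed_vector) manifold \<Rightarrow> ('a \<Rightarrow> real) \<Rightarrow> nat \<Rightarrow> (nat \<Rightarrow> 'a) \<Rightarrow> bool" where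
  "DEP_solution G M \<l> N f \<longleftrightarrow>
     (\<forall>k<N. f k \<in> carrier G) \<and>
     (\<forall>k. 0 < k \<and> k < N \<longrightarrow>
        (\<forall>\<theta>\<in>lie_algebra G M.
           - differential M \<l> (f (k - 1)) (TR G M (f (k - 1)) (Ad G M (f (k - 1)) \<theta>))
           + differential M \<l> (f k) (TR G M (f k) \<theta>) = 0))"

definition canonical_proj :: "'a monoid \<Rightarrow> 'a \<times> 'a \<Rightarrow> 'a" where
  "canonical_proj G = (\<lambda>(g, h). g \<otimes>\<^bsub>G\<^esub> inv\<^bsub>G\<^esub> h)"

primrec reconstruct :: "'a monoid \<Rightarrow> (nat \<Rightarrow> 'a) \<Rightarrow> 'a \<Rightarrow> nat \<Rightarrow> 'a" where
  "reconstruct G f g0 0 = g0"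
| "reconstruct G f g0 (Suc k) = inv\<^bsub>G\<^esub> (f k) \<otimes>\<^bsub>G\<^esub> reconstruct G f g0 k"

end

theory Submission
  imports Defs
begin

text \<open>
  Write \<open>f = g\<^sub>k\<^sub>-\<^sub>1 g\<^sub>k\<^sup>-\<^sup>1\<close> and \<open>f' = g\<^sub>k g\<^sub>k\<^sub>+\<^sub>1\<^sup>-\<^sup>1\<close> for two consecutive projected points. By right
  translation with \<open>g\<^sub>k\<close>, every tangent vector at \<open>g\<^sub>k\<close> is the velocity of \<open>c(t) g\<^sub>k\<close> for a curve \<open>c\<close>
  through the identity \<open>e\<close>, and the velocity \<open>\<theta>\<close> of \<open>c\<close> is an arbitrary element of the Lie algebra.
  Testing the discrete Euler-Lagrange equation on this vector gives
  \<open>d/dt L(g\<^sub>k\<^sub>-\<^sub>1, c g\<^sub>k) + d/dt L(c g\<^sub>k, g\<^sub>k\<^sub>+\<^sub>1)\<close> at \<open>t = 0\<close>. By invariance the second function of \<open>t\<close> is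
  \<open>L(c f', e) = \<l>(c f')\<close>, so its derivative is the differential of \<open>\<l>\<close> on the right translate of \<open>\<theta>\<close>.
  The first one is \<open>L(f, c)\<close>. Since \<open>L(f c, c) = L(f, e)\<close> does not depend on \<open>t\<close>, its derivative is the
  negative of that of \<open>L(f c, e) = \<l>(f c)\<close> (\<open>invariance_derivative\<close>), and \<open>f c = (f c f\<^sup>-\<^sup>1) f\<close>
  represents the right translate by \<open>f\<close> of \<open>Ad\<^sub>f \<theta>\<close>. Hence at each interior index the two covectors
  are the same (\<open>DEL_eq_DEP\<close>, \<open>DEL_iff_DEP_at\<close>), and both parts of the theorem follow, because
  the reconstruction of \<open>f\<close> projects to \<open>f\<close> (\<open>reconstruct_projection\<close>).

  The analytic input is the chain rule for a smooth function of two curves, which is additive in the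
  two velocities (\<open>smooth_function_along_curves\<close>). Tangent vectors are classes of smooth curves, so
  translated curves such as \<open>c(t) g\<^sub>k\<close> have to define tangent vectors too. The proof works with curves
  that are merely differentiable at \<open>0\<close>: these are stable under multiplication by the first-order
  chain rule, and each of them has the velocity of a smooth curve, a straight line in a chart
  (\<open>differentiable_curve_at_representative\<close>). Thus only compositions with affine maps have
  to be shown to be smooth, and derivatives of higher order of general composites never occur.
\<close>


section \<open>Curves that are differentiable at one point\<close>

text \<open>
  Differentiability in charts does not see whether a curve that stays outside of the chart domain
  approaches \<open>p\<close>, hence the separate limit condition. The filter \<open>nhds 0\<close> includes \<open>t = 0\<close>, so
  statements that hold eventually along it can be used at the base point as well.
\<close>

definition differentiable_curve_at ::
  "('a, 'e::real_normed_vector) manifold \<Rightarrow> 'a \<Rightarrow> (real \<Rightarrow> 'a) \<Rightarrow> bool" where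
  "differentiable_curve_at M p \<gamma> \<longleftrightarrow> \<gamma> 0 = p \<and> limitin (mtop M) \<gamma> p (nhds 0) \<and>
     (\<forall>(U, \<phi>)\<in>atlas M. p \<in> U \<longrightarrow> (\<phi> \<circ> \<gamma>) differentiable (at 0))"

lemma differentiable_curve_atD:
  assumes "differentiable_curve_at M p \<gamma>"
  shows "\<gamma> 0 = p" and "p \<in> topspace (mtop M)" and "limitin (mtop M) \<gamma> p (nhds 0)"
    and "\<And>U. openin (mtop M) U \<Longrightarrow> p \<in> U \<Longrightarrow> \<forall>\<^sub>F t in nhds 0. \<gamma> t \<in> U"
    and "\<And>U \<phi>. (U, \<phi>) \<in> atlas M \<Longrightarrow> p \<in> U \<Longrightarrow>
           ((\<phi> \<circ> \<gamma>) has_vector_derivative vector_derivative (\<phi> \<circ> \<gamma>) (at 0)) (at 0)"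
  using assms unfolding differentiable_curve_at_def limitin_def
  by (auto simp: vector_derivative_works[symmetric])

lemma differentiable_curve_at_const:
  assumes "p \<in> topspace (mtop M)"
  shows "differentiable_curve_at M p (\<lambda>_. p)"
  using assms by (auto simp: differentiable_curve_at_def o_def limitin_const_iff)

lemma has_vector_derivative_eventually_eq:
  assumes "(f has_vector_derivative d) (at a)" and "\<forall>\<^sub>F t in nhds a. g t = f t"
  shows "(g has_vector_derivative d) (at a)"
proof -
  obtain S where "open S" "a \<in> S" "\<And>t. t \<in> S \<Longrightarrow> g t = f t"
    using assms(2) by (auto simp: eventually_nhds)
  then show ?thesis
    using has_vector_derivative_transform_within_open[OF assms(1)] by metis
qed

lemma has_real_derivative_eventually_eq:
  assumes "(f has_real_derivative d) (at a)" and "\<forall>\<^sub>F t in nhds a. g t = f t"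
  shows "(g has_real_derivative d) (at a)"
  using DERIV_cong_ev[OF refl assms(2) refl] assms(1) by simp

lemma has_vector_derivative_compose:
  assumes "(f has_vector_derivative v) (at a)" and "(g has_derivative D) (at (f a))"
  shows "((g \<circ> f) has_vector_derivative D v) (at a)"
  by (rule vector_derivative_diff_chain_within[OF assms(1) has_derivative_at_withinI[OF assms(2)]])

lemma curve_at_imp_differentiable:
  assumes "curve_at M p \<gamma>"
    and charts_open: "\<And>U \<phi>. (U, \<phi>) \<in> atlas M \<Longrightarrow> openin (mtop M) U"
  shows "differentiable_curve_at M p \<gamma>"
proof -
  obtain \<epsilon> :: real where 0: "\<gamma> 0 = p" and "\<epsilon> > 0"
    and sm: "smooth_map (open_submanifold {-\<epsilon><..<\<epsilon>}) M \<gamma>"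
    using assms(1) by (auto simp: curve_at_def)
  let ?I = "{-\<epsilon><..<\<epsilon>}"
  have I: "open ?I" "0 \<in> ?I" using \<open>\<epsilon> > 0\<close> by auto
  have cont: "continuous_map (top_of_set ?I) (mtop M) \<gamma>"
    using sm by (simp add: smooth_map_def open_submanifold_def)
  have "limitin (top_of_set ?I) (\<lambda>t. t) 0 (nhds 0)"
    using I eventually_nhds_in_open[OF I]
    by (auto simp: limitin_subtopology filterlim_ident)
  from continuous_map_limit[OF cont this] 0
  have lim: "limitin (mtop M) \<gamma> p (nhds 0)" by (simp add: o_def)
  have "(\<phi> \<circ> \<gamma>) differentiable (at 0)" if c: "(U, \<phi>) \<in> atlas M" "p \<in> U" for U \<phi>
  proof -
    let ?g = "\<phi> \<circ> \<gamma> \<circ> inv_into ?I id"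
    have "smooth_on (id ` (?I \<inter> \<gamma> -` U)) ?g"
      using sm c by (auto simp: smooth_map_def open_submanifold_def)
    then have "Ck_on (Suc 0) (id ` (?I \<inter> \<gamma> -` U)) ?g"
      unfolding smooth_on_def by blast
    moreover have "0 \<in> id ` (?I \<inter> \<gamma> -` U)" using I 0 c by auto
    ultimately have "?g differentiable (at 0)" by (simp only: Ck_on.simps)
    then have "(?g has_vector_derivative vector_derivative ?g (at 0)) (at 0)"
      by (simp add: vector_derivative_works)
    moreover have "\<forall>\<^sub>F t in nhds 0. (\<phi> \<circ> \<gamma>) t = ?g t"
      using eventually_nhds_in_open[OF I]
      by eventually_elim (metis comp_apply f_inv_into_f id_apply image_id)
    ultimately show ?thesis
      using has_vector_derivative_eventually_eq differentiableI_vector by blast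
  qed
  then show ?thesis using 0 lim by (auto simp: differentiable_curve_at_def)
qed

lemma (in smooth_manifold) chart_at:
  assumes "p \<in> topspace (mtop M)"
  obtains U \<phi> where "(U, \<phi>) \<in> atlas M" "p \<in> U"
  using assms unfolding atlas_covers[symmetric] by auto

lemma (in smooth_manifold) chart_inj_on: "(U, \<phi>) \<in> atlas M \<Longrightarrow> inj_on \<phi> U"
  using chart_homeomorphic[of U \<phi>] homeomorphic_imp_injective_map[of "subtopology (mtop M) U"]
    openin_subset[OF chart_openin[of U \<phi>]]
  by (simp add: inf.absorb2)

text \<open>
  The derivative \<open>D\<close> of the coordinate expression of \<open>F\<close> is chosen before the curves: this is what
  makes the velocity of \<open>F(\<alpha>, \<beta>)\<close> depend on the velocities of \<open>\<alpha>\<close> and \<open>\<beta>\<close> only, and additively.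
\<close>

lemma smooth_map_along_curves:
  fixes M1 :: "('a, 'e::real_inner) manifold" and M2 :: "('b, 'f::real_inner) manifold"
    and N :: "('c, 'g::real_normed_vector) manifold"
  assumes M1: "smooth_manifold M1" and M2: "smooth_manifold M2"
    and F: "smooth_map (prod_manifold M1 M2) N F"
    and U: "(U, \<phi>) \<in> atlas M1" "p \<in> U" and V: "(V, \<psi>) \<in> atlas M2" "q \<in> V"
    and W: "(W, \<kappa>) \<in> atlas N" "F (p, q) \<in> W"
  obtains D where "bounded_linear D"
    and "\<And>\<alpha> \<beta>. differentiable_curve_at M1 p \<alpha> \<Longrightarrow> differentiable_curve_at M2 q \<beta> \<Longrightarrow>
           ((\<kappa> \<circ> (\<lambda>t. F (\<alpha> t, \<beta> t))) has_vector_derivative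
             D (vector_derivative (\<phi> \<circ> \<alpha>) (at 0), vector_derivative (\<psi> \<circ> \<beta>) (at 0))) (at 0)"
proof -
  let ?\<Phi> = "\<kappa> \<circ> F \<circ> inv_into (U \<times> V) (map_prod \<phi> \<psi>)"
  have "(U \<times> V, map_prod \<phi> \<psi>) \<in> atlas (prod_manifold M1 M2)"
    using U V by (auto simp: prod_manifold_def)
  with F W have "smooth_on (map_prod \<phi> \<psi> ` (U \<times> V \<inter> F -` W)) ?\<Phi>"
    unfolding smooth_map_def by fast
  then have "Ck_on (Suc 0) (map_prod \<phi> \<psi> ` (U \<times> V \<inter> F -` W)) ?\<Phi>"
    unfolding smooth_on_def by blast
  moreover have "(\<phi> p, \<psi> q) \<in> map_prod \<phi> \<psi> ` (U \<times> V \<inter> F -` W)"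
    using U V W by force
  ultimately have "?\<Phi> differentiable (at (\<phi> p, \<psi> q))" by (simp only: Ck_on.simps)
  then obtain D where D: "(?\<Phi> has_derivative D) (at (\<phi> p, \<psi> q))"
    by (auto simp: differentiable_def)
  have inj: "inj_on (map_prod \<phi> \<psi>) (U \<times> V)"
    using smooth_manifold.chart_inj_on[OF M1 U(1)] smooth_manifold.chart_inj_on[OF M2 V(1)]
    by (rule map_prod_inj_on)
  show thesis
  proof (rule that)
    show "bounded_linear D" using D by (rule has_derivative_bounded_linear)
    fix \<alpha> \<beta> assume \<alpha>: "differentiable_curve_at M1 p \<alpha>" and \<beta>: "differentiable_curve_at M2 q \<beta>"
    let ?d = "(vector_derivative (\<phi> \<circ> \<alpha>) (at 0), vector_derivative (\<psi> \<circ> \<beta>) (at 0))"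
    have "((\<lambda>t. ((\<phi> \<circ> \<alpha>) t, (\<psi> \<circ> \<beta>) t)) has_vector_derivative ?d) (at 0)"
      by (intro has_vector_derivative_Pair differentiable_curve_atD(5)[OF \<alpha> U]
          differentiable_curve_atD(5)[OF \<beta> V])
    then have "((?\<Phi> \<circ> (\<lambda>t. ((\<phi> \<circ> \<alpha>) t, (\<psi> \<circ> \<beta>) t))) has_vector_derivative D ?d) (at 0)"
      by (rule has_vector_derivative_compose)
        (use D differentiable_curve_atD(1)[OF \<alpha>] differentiable_curve_atD(1)[OF \<beta>] in \<open>simp add: o_def\<close>)
    moreover have "\<forall>\<^sub>F t in nhds 0. \<alpha> t \<in> U" "\<forall>\<^sub>F t in nhds 0. \<beta> t \<in> V"
      using differentiable_curve_atD(4)[OF \<alpha> smooth_manifold.chart_openin[OF M1 U(1)] U(2)]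
        differentiable_curve_atD(4)[OF \<beta> smooth_manifold.chart_openin[OF M2 V(1)] V(2)] by auto
    \<comment> \<open>equality near \<open>0\<close> only: outside of the chart domains the coordinate expression is arbitrary\<close>
    then have "\<forall>\<^sub>F t in nhds 0. (\<kappa> \<circ> (\<lambda>t. F (\<alpha> t, \<beta> t))) t
        = (?\<Phi> \<circ> (\<lambda>t. ((\<phi> \<circ> \<alpha>) t, (\<psi> \<circ> \<beta>) t))) t"
    proof eventually_elim
      case (elim t)
      then have "inv_into (U \<times> V) (map_prod \<phi> \<psi>) (map_prod \<phi> \<psi> (\<alpha> t, \<beta> t)) = (\<alpha> t, \<beta> t)"
        using inj by (intro inv_into_f_f) auto
      then show ?case by simp
    qed
    ultimately show "((\<kappa> \<circ> (\<lambda>t. F (\<alpha> t, \<beta> t))) has_vector_derivative D ?d) (at 0)"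
      by (rule has_vector_derivative_eventually_eq)
  qed
qed

lemma differentiable_curve_at_smooth_map:
  fixes M1 :: "('a, 'e::real_inner) manifold" and M2 :: "('b, 'f::real_inner) manifold"
    and N :: "('c, 'g::real_normed_vector) manifold"
  assumes M1: "smooth_manifold M1" and M2: "smooth_manifold M2"
    and F: "smooth_map (prod_manifold M1 M2) N F"
    and \<alpha>: "differentiable_curve_at M1 p \<alpha>" and \<beta>: "differentiable_curve_at M2 q \<beta>"
  shows "differentiable_curve_at N (F (p, q)) (\<lambda>t. F (\<alpha> t, \<beta> t))"
  unfolding differentiable_curve_at_def
proof (intro conjI ballI, goal_cases)
  case 1
  show ?case using \<alpha> \<beta> by (simp add: differentiable_curve_atD(1))
next
  case 2
  have lim: "limitin (prod_topology (mtop M1) (mtop M2)) (\<lambda>t. (\<alpha> t, \<beta> t)) (p, q) (nhds 0)"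
    using differentiable_curve_atD(3)[OF \<alpha>] differentiable_curve_atD(3)[OF \<beta>]
    by (simp add: limitin_pairwise o_def)
  have "continuous_map (prod_topology (mtop M1) (mtop M2)) (mtop N) F"
    using F by (simp add: smooth_map_def prod_manifold_def)
  from continuous_map_limit[OF this lim] show ?case by (simp add: o_def)
next
  case (3 c)
  obtain W \<kappa> where c: "c = (W, \<kappa>)" by (cases c)
  obtain U \<phi> where U: "(U, \<phi>) \<in> atlas M1" "p \<in> U"
    using smooth_manifold.chart_at[OF M1 differentiable_curve_atD(2)[OF \<alpha>]] .
  obtain V \<psi> where V: "(V, \<psi>) \<in> atlas M2" "q \<in> V"
    using smooth_manifold.chart_at[OF M2 differentiable_curve_atD(2)[OF \<beta>]] .
  have "(\<kappa> \<circ> (\<lambda>t. F (\<alpha> t, \<beta> t))) differentiable (at 0)" if W: "F (p, q) \<in> W"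
  proof (rule smooth_map_along_curves[OF M1 M2 F U V _ W])
    show "(W, \<kappa>) \<in> atlas N" using 3 c by simp
    fix D assume "\<And>\<alpha> \<beta>. differentiable_curve_at M1 p \<alpha> \<Longrightarrow> differentiable_curve_at M2 q \<beta> \<Longrightarrow>
           ((\<kappa> \<circ> (\<lambda>t. F (\<alpha> t, \<beta> t))) has_vector_derivative
             D (vector_derivative (\<phi> \<circ> \<alpha>) (at 0), vector_derivative (\<psi> \<circ> \<beta>) (at 0))) (at 0)"
    from this[OF \<alpha> \<beta>] show ?thesis by (rule differentiableI_vector)
  qed
  then show ?case by (simp add: c)
qed

lemma same_velocity_smooth_map:
  fixes M1 :: "('a, 'e::real_inner) manifold" and M2 :: "('b, 'f::real_inner) manifold"
    and N :: "('c, 'g::real_normed_vector) manifold"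
  assumes M1: "smooth_manifold M1" and M2: "smooth_manifold M2"
    and F: "smooth_map (prod_manifold M1 M2) N F"
    and \<alpha>: "differentiable_curve_at M1 p \<alpha>" "differentiable_curve_at M1 p \<alpha>'"
    and \<beta>: "differentiable_curve_at M2 q \<beta>" "differentiable_curve_at M2 q \<beta>'"
    and same: "same_velocity M1 p \<alpha> \<alpha>'" "same_velocity M2 q \<beta> \<beta>'"
  shows "same_velocity N (F (p, q)) (\<lambda>t. F (\<alpha> t, \<beta> t)) (\<lambda>t. F (\<alpha>' t, \<beta>' t))"
proof -
  obtain U \<phi> where U: "(U, \<phi>) \<in> atlas M1" "p \<in> U"
    using smooth_manifold.chart_at[OF M1 differentiable_curve_atD(2)[OF \<alpha>(1)]] .
  obtain V \<psi> where V: "(V, \<psi>) \<in> atlas M2" "q \<in> V"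
    using smooth_manifold.chart_at[OF M2 differentiable_curve_atD(2)[OF \<beta>(1)]] .
  have eq: "vector_derivative (\<phi> \<circ> \<alpha>) (at 0) = vector_derivative (\<phi> \<circ> \<alpha>') (at 0)"
    "vector_derivative (\<psi> \<circ> \<beta>) (at 0) = vector_derivative (\<psi> \<circ> \<beta>') (at 0)"
    using same U V by (auto simp: same_velocity_def)
  have "vector_derivative (\<kappa> \<circ> (\<lambda>t. F (\<alpha> t, \<beta> t))) (at 0)
      = vector_derivative (\<kappa> \<circ> (\<lambda>t. F (\<alpha>' t, \<beta>' t))) (at 0)"
    if W: "(W, \<kappa>) \<in> atlas N" "F (p, q) \<in> W" for W \<kappa>
  proof (rule smooth_map_along_curves[OF M1 M2 F U V W])
    fix D assume "\<And>\<alpha> \<beta>. differentiable_curve_at M1 p \<alpha> \<Longrightarrow> differentiable_curve_at M2 q \<beta> \<Longrightarrow>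
           ((\<kappa> \<circ> (\<lambda>t. F (\<alpha> t, \<beta> t))) has_vector_derivative
             D (vector_derivative (\<phi> \<circ> \<alpha>) (at 0), vector_derivative (\<psi> \<circ> \<beta>) (at 0))) (at 0)"
    from this[OF \<alpha>(1) \<beta>(1)] this[OF \<alpha>(2) \<beta>(2)] show ?thesis
      by (simp add: eq vector_derivative_at)
  qed
  then show ?thesis by (auto simp: same_velocity_def)
qed

text \<open>
  The chain rule for the two slots of a smooth function: the constant curves contribute \<open>0\<close> to the
  argument of the linear map of \<open>smooth_map_along_curves\<close>.
\<close>

lemma smooth_function_along_curves:
  fixes M1 :: "('a, 'e::real_inner) manifold" and M2 :: "('b, 'f::real_inner) manifold"
  assumes M1: "smooth_manifold M1" and M2: "smooth_manifold M2"
    and F: "smooth_function (prod_manifold M1 M2) F"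
    and \<alpha>: "differentiable_curve_at M1 p \<alpha>" and \<beta>: "differentiable_curve_at M2 q \<beta>"
  obtains a b where "((\<lambda>t. F (\<alpha> t, \<beta> t)) has_real_derivative a + b) (at 0)"
    and "\<And>\<alpha>'. differentiable_curve_at M1 p \<alpha>' \<Longrightarrow> same_velocity M1 p \<alpha> \<alpha>' \<Longrightarrow>
           ((\<lambda>t. F (\<alpha>' t, q)) has_real_derivative a) (at 0)"
    and "\<And>\<beta>'. differentiable_curve_at M2 q \<beta>' \<Longrightarrow> same_velocity M2 q \<beta> \<beta>' \<Longrightarrow>
           ((\<lambda>t. F (p, \<beta>' t)) has_real_derivative b) (at 0)"
proof -
  obtain U \<phi> where U: "(U, \<phi>) \<in> atlas M1" "p \<in> U"
    using smooth_manifold.chart_at[OF M1 differentiable_curve_atD(2)[OF \<alpha>]] .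
  obtain V \<psi> where V: "(V, \<psi>) \<in> atlas M2" "q \<in> V"
    using smooth_manifold.chart_at[OF M2 differentiable_curve_atD(2)[OF \<beta>]] .
  have W: "(UNIV, id) \<in> atlas (open_submanifold UNIV)" "F (p, q) \<in> UNIV"
    by (auto simp: open_submanifold_def)
  obtain D where D: "bounded_linear D" and
    "\<And>\<alpha> \<beta>. differentiable_curve_at M1 p \<alpha> \<Longrightarrow> differentiable_curve_at M2 q \<beta> \<Longrightarrow>
           ((id \<circ> (\<lambda>t. F (\<alpha> t, \<beta> t))) has_vector_derivative
             D (vector_derivative (\<phi> \<circ> \<alpha>) (at 0), vector_derivative (\<psi> \<circ> \<beta>) (at 0))) (at 0)"
    using smooth_map_along_curves[OF M1 M2 F U V W] by blast
  then have deriv: "\<And>\<alpha> \<beta>. differentiable_curve_at M1 p \<alpha> \<Longrightarrow> differentiable_curve_at M2 q \<beta> \<Longrightarrow>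
           ((\<lambda>t. F (\<alpha> t, \<beta> t)) has_real_derivative
             D (vector_derivative (\<phi> \<circ> \<alpha>) (at 0), vector_derivative (\<psi> \<circ> \<beta>) (at 0))) (at 0)"
    by (simp add: has_real_derivative_iff_has_vector_derivative o_def)
  let ?a = "vector_derivative (\<phi> \<circ> \<alpha>) (at 0)" and ?b = "vector_derivative (\<psi> \<circ> \<beta>) (at 0)"
  show thesis
  proof (rule that)
    have "D (?a, ?b) = D (?a, 0) + D (0, ?b)"
      using linear_add[OF bounded_linear.linear[OF D], of "(?a, 0)" "(0, ?b)"] by simp
    then show "((\<lambda>t. F (\<alpha> t, \<beta> t)) has_real_derivative D (?a, 0) + D (0, ?b)) (at 0)"
      using deriv[OF \<alpha> \<beta>] by simp
  next
    fix \<alpha>' assume \<alpha>': "differentiable_curve_at M1 p \<alpha>'" "same_velocity M1 p \<alpha> \<alpha>'"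
    have "vector_derivative (\<phi> \<circ> \<alpha>') (at 0) = ?a"
      using \<alpha>' U by (auto simp: same_velocity_def)
    with deriv[OF \<alpha>'(1) differentiable_curve_at_const[OF differentiable_curve_atD(2)[OF \<beta>]]]
    show "((\<lambda>t. F (\<alpha>' t, q)) has_real_derivative D (?a, 0)) (at 0)" by (simp add: o_def)
  next
    fix \<beta>' assume \<beta>': "differentiable_curve_at M2 q \<beta>'" "same_velocity M2 q \<beta> \<beta>'"
    have "vector_derivative (\<psi> \<circ> \<beta>') (at 0) = ?b"
      using \<beta>' V by (auto simp: same_velocity_def)
    with deriv[OF differentiable_curve_at_const[OF differentiable_curve_atD(2)[OF \<alpha>]] \<beta>'(1)]
    show "((\<lambda>t. F (p, \<beta>' t)) has_real_derivative D (0, ?b)) (at 0)" by (simp add: o_def)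
  qed
qed


section \<open>Smooth representatives of velocities\<close>

text \<open>
  The equality must hold on an open set: derivatives at a point of \<open>S\<close> see values outside of \<open>S\<close>.
\<close>

lemma Ck_on_cong:
  assumes "Ck_on k S f" and "open T" and "S \<subseteq> T" and "\<And>x. x \<in> T \<Longrightarrow> f x = g x"
  shows "Ck_on k S g"
  using assms(1,4)
proof (induction k arbitrary: f g)
  case 0
  then have "continuous_on S f" and "\<And>x. x \<in> S \<Longrightarrow> g x = f x" using assms(3) by auto
  then show ?case by (simp cong: continuous_on_cong)
next
  case (Suc k)
  have iff: "(f has_derivative D) (at x) \<longleftrightarrow> (g has_derivative D) (at x)" if "x \<in> T" for x D
    using has_derivative_transform_within_open[OF _ assms(2) that, of f D UNIV g]
      has_derivative_transform_within_open[OF _ assms(2) that, of g D UNIV f] Suc.prems(2)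
    by metis
  have "frechet_derivative f (at x) v = frechet_derivative g (at x) v" if "x \<in> T" for x v
    unfolding frechet_derivative_def iff[OF that] ..
  moreover have "Ck_on k S (\<lambda>x. frechet_derivative f (at x) v)" for v
    using Suc.prems(1) by simp
  ultimately have "Ck_on k S (\<lambda>x. frechet_derivative g (at x) v)" for v
    using Suc.IH[of "\<lambda>x. frechet_derivative f (at x) v" "\<lambda>x. frechet_derivative g (at x) v"]
    by metis
  moreover have "g differentiable (at x)" if "x \<in> S" for x
  proof -
    have "x \<in> T" and "f differentiable (at x)" using that assms(3) Suc.prems(1) by auto
    then show ?thesis unfolding differentiable_def using iff by blast
  qed
  ultimately show ?case by simp
qed

text \<open>
  The chain rule \<open>(f(a + t v))' s = Df(a + t v) (s v)\<close> has a fixed direction \<open>s v\<close>, so the derivative is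
  again the composition of a directional derivative of \<open>f\<close> with the same line, and the induction
  closes without a product rule.
\<close>

lemma Ck_on_compose_line:
  fixes f :: "'e::real_normed_vector \<Rightarrow> 'f::real_normed_vector" and T :: "real set"
  assumes "Ck_on k S f" and "open T" and "\<And>t. t \<in> T \<Longrightarrow> a + t *\<^sub>R v \<in> S"
  shows "Ck_on k T (\<lambda>t. f (a + t *\<^sub>R v))"
  using assms(1)
proof (induction k arbitrary: f)
  case 0
  have line: "continuous_on T (\<lambda>t. a + t *\<^sub>R v)" by (intro continuous_intros)
  show ?case unfolding Ck_on.simps
    by (rule continuous_on_compose2[OF _ line]) (use 0 assms(3) in auto)
next
  case (Suc k)
  have D: "((\<lambda>t. f (a + t *\<^sub>R v)) has_derivative
      (\<lambda>s. frechet_derivative f (at (a + t *\<^sub>R v)) (s *\<^sub>R v))) (at t)" if "t \<in> T" for t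
  proof -
    have "(f has_derivative frechet_derivative f (at (a + t *\<^sub>R v))) (at (a + t *\<^sub>R v))"
      using Suc.prems assms(3)[OF that] by (simp add: frechet_derivative_works[symmetric])
    moreover have "((\<lambda>t. a + t *\<^sub>R v) has_derivative (\<lambda>s. s *\<^sub>R v)) (at t)"
      by (auto intro!: derivative_eq_intros)
    ultimately show ?thesis by (rule has_derivative_compose[rotated])
  qed
  have "Ck_on k T (\<lambda>t. frechet_derivative (\<lambda>t. f (a + t *\<^sub>R v)) (at t) s)" for s
  proof (rule Ck_on_cong[OF _ assms(2) order_refl])
    show "Ck_on k T (\<lambda>t. frechet_derivative f (at (a + t *\<^sub>R v)) (s *\<^sub>R v))"
      using Suc.prems by (intro Suc.IH) simp
    show "frechet_derivative f (at (a + t *\<^sub>R v)) (s *\<^sub>R v) =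
        frechet_derivative (\<lambda>t. f (a + t *\<^sub>R v)) (at t) s" if "t \<in> T" for t
      by (rule fun_cong[OF frechet_derivative_at[OF D[OF that]]])
  qed
  moreover have "(\<lambda>t. f (a + t *\<^sub>R v)) differentiable (at t)" if "t \<in> T" for t
    using D[OF that] by (auto simp: differentiable_def)
  ultimately show ?case by simp
qed

text \<open>
  The curve is the straight line \<open>\<phi> p + t v\<close> in the chart. In any other chart it is a transition map
  composed with a line, hence smooth.
\<close>

lemma (in smooth_manifold) curve_at_with_derivative:
  assumes U: "(U, \<phi>) \<in> atlas M" "p \<in> U"
  obtains \<gamma> where "curve_at M p \<gamma>" and "vector_derivative (\<phi> \<circ> \<gamma>) (at 0) = v"
proof -
  define A where "A = (\<lambda>t::real. \<phi> p + t *\<^sub>R v)"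
  define \<gamma> where "\<gamma> = inv_into U \<phi> \<circ> A"
  have contA: "continuous_on S A" for S unfolding A_def by (intro continuous_intros)
  have "open (A -` (\<phi> ` U))"
    using chart_open_image[OF U(1)] contA by (simp add: open_vimage)
  moreover have "0 \<in> A -` (\<phi> ` U)" using U by (simp add: A_def)
  ultimately obtain \<epsilon> where \<epsilon>: "\<epsilon> > 0" "ball 0 \<epsilon> \<subseteq> A -` (\<phi> ` U)"
    by (meson open_contains_ball)
  define I where "I = {-\<epsilon><..<\<epsilon>}"
  have I: "open I" "0 \<in> I" using \<epsilon> by (auto simp: I_def)
  have AI: "A t \<in> \<phi> ` U" if "t \<in> I" for t
    using \<epsilon> that by (auto simp: I_def subset_iff)
  have \<gamma>U: "\<gamma> t \<in> U" "\<phi> (\<gamma> t) = A t" if "t \<in> I" for t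
    using AI[OF that] by (auto simp: \<gamma>_def inv_into_into f_inv_into_f)
  have \<gamma>0: "\<gamma> 0 = p"
    using U chart_inj_on[OF U(1)] by (simp add: \<gamma>_def A_def)
  have UT: "U \<subseteq> topspace (mtop M)" using openin_subset[OF chart_openin[OF U(1)]] .
  have "continuous_map (top_of_set I) (mtop M) \<gamma>"
  proof -
    obtain \<phi>' where \<phi>': "homeomorphic_maps (subtopology (mtop M) U) (top_of_set (\<phi> ` U)) \<phi> \<phi>'"
      using chart_homeomorphic[OF U(1)] by (auto simp: homeomorphic_map_maps)
    have "continuous_map (top_of_set I) (top_of_set (\<phi> ` U)) A"
      using AI contA by (auto simp: continuous_map_in_subtopology)
    moreover have "continuous_map (top_of_set (\<phi> ` U)) (mtop M) \<phi>'"
      using \<phi>' by (auto simp: homeomorphic_maps_def continuous_map_in_subtopology)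
    ultimately have "continuous_map (top_of_set I) (mtop M) (\<phi>' \<circ> A)"
      by (rule continuous_map_compose)
    moreover have "(\<phi>' \<circ> A) t = \<gamma> t" if "t \<in> I" for t
    proof -
      have "\<phi>' (\<phi> (\<gamma> t)) = \<gamma> t"
        using \<phi>' \<gamma>U(1)[OF that] UT by (auto simp: homeomorphic_maps_def)
      then show ?thesis using \<gamma>U(2)[OF that] by simp
    qed
    ultimately show ?thesis using continuous_map_eq[of "top_of_set I" "mtop M" "\<phi>' \<circ> A" \<gamma>] by simp
  qed
  moreover have "smooth_on (id ` (I \<inter> \<gamma> -` V)) (\<psi> \<circ> \<gamma> \<circ> inv_into I id)"
    if V: "(V, \<psi>) \<in> atlas M" for V \<psi>
    unfolding smooth_on_def
  proof
    fix k
    have transition: "Ck_on k (\<phi> ` (U \<inter> V)) (\<psi> \<circ> inv_into U \<phi>)"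
      using smooth_transition[OF U(1) V] by (simp add: smooth_on_def)
    have dom: "I \<inter> \<gamma> -` V = I \<inter> A -` (\<phi> ` (U \<inter> V))"
    proof -
      have "\<gamma> t \<in> V \<longleftrightarrow> A t \<in> \<phi> ` (U \<inter> V)" if "t \<in> I" for t
        using inj_on_image_mem_iff[OF chart_inj_on[OF U(1)] \<gamma>U(1)[OF that], of "U \<inter> V"]
          \<gamma>U[OF that] by simp
      then show ?thesis by auto
    qed
    have opn: "open (I \<inter> A -` (\<phi> ` (U \<inter> V)))"
    proof -
      have "openin (top_of_set (\<phi> ` U)) (\<phi> ` (U \<inter> V))"
        using homeomorphic_map_openness[OF chart_homeomorphic[OF U(1)], of "U \<inter> V"] UT
          openin_subtopology_Int2[OF chart_openin[OF V], of U] by auto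
      then have "open (\<phi> ` (U \<inter> V))"
        using chart_open_image[OF U(1)] by (metis openin_open_eq)
      then show ?thesis using I contA by (intro open_Int open_vimage) auto
    qed
    have "Ck_on k (I \<inter> \<gamma> -` V) (\<lambda>t. (\<psi> \<circ> inv_into U \<phi>) (\<phi> p + t *\<^sub>R v))"
      by (rule Ck_on_compose_line[OF transition]) (use dom opn in \<open>auto simp: A_def\<close>)
    then have "Ck_on k (I \<inter> \<gamma> -` V) (\<psi> \<circ> \<gamma> \<circ> inv_into I id)"
    proof (rule Ck_on_cong[OF _ I(1)])
      show "(\<psi> \<circ> inv_into U \<phi>) (\<phi> p + t *\<^sub>R v) = (\<psi> \<circ> \<gamma> \<circ> inv_into I id) t" if "t \<in> I" for t
        using inv_into_f_f[of id I t] that by (simp add: \<gamma>_def A_def)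
    qed auto
    then show "Ck_on k (id ` (I \<inter> \<gamma> -` V)) (\<psi> \<circ> \<gamma> \<circ> inv_into I id)" by simp
  qed
  ultimately have "smooth_map (open_submanifold I) M \<gamma>"
    by (auto simp: smooth_map_def open_submanifold_def)
  then have "curve_at M p \<gamma>"
    using \<gamma>0 \<epsilon>(1) by (auto simp: curve_at_def I_def)
  moreover have "vector_derivative (\<phi> \<circ> \<gamma>) (at 0) = v"
  proof (rule vector_derivative_at, rule has_vector_derivative_eventually_eq)
    show "(A has_vector_derivative v) (at 0)"
      unfolding A_def by (auto intro!: derivative_eq_intros)
    show "\<forall>\<^sub>F t in nhds 0. (\<phi> \<circ> \<gamma>) t = A t"
      using eventually_nhds_in_open[OF I] by eventually_elim (simp add: \<gamma>U)
  qed
  ultimately show thesis by (rule that)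
qed

context smooth_manifold
begin

lemma curve_at_differentiable: "curve_at M p \<gamma> \<Longrightarrow> differentiable_curve_at M p \<gamma>"
  by (erule curve_at_imp_differentiable) (rule chart_openin)

text \<open>
  Coordinate velocities in two charts are related by the derivative of the transition map, so one
  chart decides.
\<close>

lemma same_velocity_if_chart:
  assumes \<alpha>: "differentiable_curve_at M p \<alpha>" and \<beta>: "differentiable_curve_at M p \<beta>"
    and U: "(U, \<phi>) \<in> atlas M" "p \<in> U"
    and eq: "vector_derivative (\<phi> \<circ> \<alpha>) (at 0) = vector_derivative (\<phi> \<circ> \<beta>) (at 0)"
  shows "same_velocity M p \<alpha> \<beta>"
proof -
  have "vector_derivative (\<psi> \<circ> \<alpha>) (at 0) = vector_derivative (\<psi> \<circ> \<beta>) (at 0)"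
    if V: "(V, \<psi>) \<in> atlas M" "p \<in> V" for V \<psi>
  proof -
    let ?T = "\<psi> \<circ> inv_into U \<phi>"
    have "Ck_on (Suc 0) (\<phi> ` (U \<inter> V)) ?T"
      using smooth_transition[OF U(1) V(1)] unfolding smooth_on_def by blast
    then have "?T differentiable (at (\<phi> p))"
      using U V by (simp only: Ck_on.simps) blast
    then obtain D where D: "(?T has_derivative D) (at (\<phi> p))"
      by (auto simp: differentiable_def)
    have "((\<psi> \<circ> \<gamma>) has_vector_derivative D (vector_derivative (\<phi> \<circ> \<gamma>) (at 0))) (at 0)"
      if \<gamma>: "differentiable_curve_at M p \<gamma>" for \<gamma>
    proof (rule has_vector_derivative_eventually_eq)
      show "((?T \<circ> (\<phi> \<circ> \<gamma>)) has_vector_derivative D (vector_derivative (\<phi> \<circ> \<gamma>) (at 0))) (at 0)"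
        by (rule has_vector_derivative_compose[OF differentiable_curve_atD(5)[OF \<gamma> U]])
          (use D differentiable_curve_atD(1)[OF \<gamma>] in \<open>simp add: o_def\<close>)
      show "\<forall>\<^sub>F t in nhds 0. (\<psi> \<circ> \<gamma>) t = (?T \<circ> (\<phi> \<circ> \<gamma>)) t"
        using differentiable_curve_atD(4)[OF \<gamma> chart_openin[OF U(1)] U(2)]
        by eventually_elim (simp add: chart_inj_on[OF U(1)])
    qed
    from this[OF \<alpha>] this[OF \<beta>] eq show ?thesis by (metis vector_derivative_at)
  qed
  then show ?thesis by (auto simp: same_velocity_def)
qed

text \<open>
  This allows velocities of curves that are only differentiable at \<open>0\<close> to serve as tangent vectors.
\<close>

lemma differentiable_curve_at_representative:
  assumes \<alpha>: "differentiable_curve_at M p \<alpha>"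
  obtains \<gamma> where "curve_at M p \<gamma>" and "same_velocity M p \<alpha> \<gamma>"
proof -
  obtain U \<phi> where U: "(U, \<phi>) \<in> atlas M" "p \<in> U"
    using chart_at[OF differentiable_curve_atD(2)[OF \<alpha>]] .
  obtain \<gamma> where \<gamma>: "curve_at M p \<gamma>"
    "vector_derivative (\<phi> \<circ> \<gamma>) (at 0) = vector_derivative (\<phi> \<circ> \<alpha>) (at 0)"
    using curve_at_with_derivative[OF U] by blast
  then show thesis
    using that same_velocity_if_chart[OF \<alpha> curve_at_differentiable U] by metis
qed

end

lemma same_velocity_refl: "same_velocity M p \<alpha> \<alpha>"
  by (auto simp: same_velocity_def)

lemma velocity_eq_if_same_velocity:
  "same_velocity M p \<alpha> \<beta> \<Longrightarrow> velocity M p \<alpha> = velocity M p \<beta>"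
  by (fastforce simp: velocity_def same_velocity_def)

lemma same_velocity_eventually_eq:
  assumes \<beta>: "differentiable_curve_at M p \<beta>" and eq: "\<forall>\<^sub>F t in nhds 0. \<alpha> t = \<beta> t"
  shows "same_velocity M p \<alpha> \<beta>"
proof -
  have "vector_derivative (\<phi> \<circ> \<alpha>) (at 0) = vector_derivative (\<phi> \<circ> \<beta>) (at 0)"
    if "(U, \<phi>) \<in> atlas M" "p \<in> U" for U \<phi>
    by (rule vector_derivative_at,
        rule has_vector_derivative_eventually_eq[OF differentiable_curve_atD(5)[OF \<beta> that]])
      (use eq in eventually_elim, simp)
  then show ?thesis by (auto simp: same_velocity_def)
qed


section \<open>Differentials and tangent maps on velocities\<close>

context smooth_manifold
begin

lemma velocity_in_tangent_space:
  assumes "differentiable_curve_at M p \<alpha>"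
  shows "velocity M p \<alpha> \<in> tangent_space M p"
  using differentiable_curve_at_representative[OF assms] velocity_eq_if_same_velocity
  by (metis (mono_tags, lifting) mem_Collect_eq tangent_space_def)

text \<open>
  The differential and the tangent map are defined through all representatives of a class. The next
  two lemmas evaluate them on one representative, given independence of the choice.
\<close>

lemma differential_velocity:
  assumes \<alpha>: "differentiable_curve_at M p \<alpha>"
    and d: "\<And>\<delta>. differentiable_curve_at M p \<delta> \<Longrightarrow> same_velocity M p \<alpha> \<delta> \<Longrightarrow>
              ((\<lambda>t. f (\<delta> t)) has_real_derivative d) (at 0)"
  shows "differential M f p (velocity M p \<alpha>) = d"
proof -
  have all: "((f \<circ> \<delta>) has_real_derivative d) (at 0)" if "\<delta> \<in> velocity M p \<alpha>" for \<delta>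
    using that d curve_at_differentiable by (auto simp: velocity_def o_def)
  obtain \<gamma> where "\<gamma> \<in> velocity M p \<alpha>"
    using differentiable_curve_at_representative[OF \<alpha>] by (auto simp: velocity_def)
  then have "(THE d. \<forall>\<gamma>\<in>velocity M p \<alpha>. ((f \<circ> \<gamma>) has_real_derivative d) (at 0)) = d"
    using all DERIV_unique by (intro the_equality) blast+
  then show ?thesis
    using velocity_in_tangent_space[OF \<alpha>] by (simp add: differential_def)
qed

lemma tangent_map_velocity:
  assumes \<alpha>: "differentiable_curve_at M p \<alpha>"
    and F: "\<And>\<delta>. differentiable_curve_at M p \<delta> \<Longrightarrow> same_velocity M p \<alpha> \<delta> \<Longrightarrow>
              same_velocity N (F p) (\<lambda>t. F (\<alpha> t)) (\<lambda>t. F (\<delta> t))"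
  shows "tangent_map M N F p (velocity M p \<alpha>) = velocity N (F p) (\<lambda>t. F (\<alpha> t))"
proof -
  have "velocity N (F p) (F \<circ> \<delta>) = velocity N (F p) (\<lambda>t. F (\<alpha> t))"
    if "\<delta> \<in> velocity M p \<alpha>" for \<delta>
    using that F[of \<delta>] curve_at_differentiable velocity_eq_if_same_velocity
    by (fastforce simp: velocity_def o_def)
  moreover have "velocity M p \<alpha> \<noteq> {}"
    using differentiable_curve_at_representative[OF \<alpha>] by (auto simp: velocity_def)
  ultimately show ?thesis by (auto simp: tangent_map_def)
qed

end


section \<open>Translations of curves in a Lie group\<close>

context lie_group
begin

lemma manifold: "smooth_manifold M" ..

lemma curve_mult:
  assumes "differentiable_curve_at M p \<alpha>" and "differentiable_curve_at M q \<beta>"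
  shows "differentiable_curve_at M (p \<otimes> q) (\<lambda>t. \<alpha> t \<otimes> \<beta> t)"
  using differentiable_curve_at_smooth_map[OF manifold manifold smooth_mult assms] by simp

lemma curve_const: "g \<in> carrier G \<Longrightarrow> differentiable_curve_at M g (\<lambda>_. g)"
  by (simp add: differentiable_curve_at_const topspace_carrier)

lemma same_velocity_mult:
  assumes "differentiable_curve_at M p \<alpha>" "differentiable_curve_at M p \<alpha>'"
    and "differentiable_curve_at M q \<beta>" "differentiable_curve_at M q \<beta>'"
    and "same_velocity M p \<alpha> \<alpha>'" "same_velocity M q \<beta> \<beta>'"
  shows "same_velocity M (p \<otimes> q) (\<lambda>t. \<alpha> t \<otimes> \<beta> t) (\<lambda>t. \<alpha>' t \<otimes> \<beta>' t)"
  using same_velocity_smooth_map[OF manifold manifold smooth_mult assms] by simp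

lemma curve_in_carrier:
  assumes "differentiable_curve_at M p \<alpha>"
  shows "\<forall>\<^sub>F t in nhds 0. \<alpha> t \<in> carrier G"
  using differentiable_curve_atD(4)[OF assms openin_topspace differentiable_curve_atD(2)[OF assms]]
  by (simp add: topspace_carrier)

lemma TR_velocity:
  assumes c: "differentiable_curve_at M \<one> c" and f: "f \<in> carrier G"
  shows "TR G M f (velocity M \<one> c) = velocity M f (\<lambda>t. c t \<otimes> f)"
proof -
  have "tangent_map M M (\<lambda>g. g \<otimes> f) \<one> (velocity M \<one> c) = velocity M (\<one> \<otimes> f) (\<lambda>t. c t \<otimes> f)"
    by (rule tangent_map_velocity[OF c])
      (intro same_velocity_mult curve_const c same_velocity_refl f)
  then show ?thesis using f by (simp add: TR_def)
qed

lemma Ad_velocity: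
  assumes c: "differentiable_curve_at M \<one> c" and f: "f \<in> carrier G"
  shows "Ad G M f (velocity M \<one> c) = velocity M \<one> (\<lambda>t. f \<otimes> c t \<otimes> inv f)"
proof -
  have "tangent_map M M (\<lambda>g. f \<otimes> g \<otimes> inv f) \<one> (velocity M \<one> c)
      = velocity M (f \<otimes> \<one> \<otimes> inv f) (\<lambda>t. f \<otimes> c t \<otimes> inv f)"
    by (rule tangent_map_velocity[OF c])
      (intro same_velocity_mult curve_mult curve_const c same_velocity_refl f inv_closed)
  then show ?thesis using f by (simp add: Ad_def)
qed

end


section \<open>The two equations agree\<close>

locale invariant_lagrangian = lie_group G M
  for G :: "'a monoid" (structure) and M :: "('a, 'e::real_inner) manifold" +
  fixes L :: "'a \<times> 'a \<Rightarrow> real" and \<l> :: "'a \<Rightarrow> real"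
  assumes smooth_L: "smooth_function (prod_manifold M M) L"
    and invariant: "g1 \<in> carrier G \<Longrightarrow> g2 \<in> carrier G \<Longrightarrow> h \<in> carrier G \<Longrightarrow>
           L (g1 \<otimes> h, g2 \<otimes> h) = L (g1, g2)"
    and reduced: "g1 \<in> carrier G \<Longrightarrow> g2 \<in> carrier G \<Longrightarrow> \<l> (g1 \<otimes> inv g2) = L (g1, g2)"
begin

lemma reduced_eq: "x \<in> carrier G \<Longrightarrow> \<l> x = L (x, \<one>)"
  using reduced[of x \<one>] by simp

lemma D1_velocity:
  assumes \<alpha>: "differentiable_curve_at M p \<alpha>" and h: "h \<in> carrier G"
  shows "((\<lambda>t. L (\<alpha> t, h)) has_real_derivative D1 M L p h (velocity M p \<alpha>)) (at 0)"
proof (rule smooth_function_along_curves[OF manifold manifold smooth_L \<alpha> curve_const[OF h]])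
  fix a assume a: "\<And>\<delta>. differentiable_curve_at M p \<delta> \<Longrightarrow> same_velocity M p \<alpha> \<delta> \<Longrightarrow>
      ((\<lambda>t. L (\<delta> t, h)) has_real_derivative a) (at 0)"
  have "D1 M L p h (velocity M p \<alpha>) = a"
    unfolding D1_def by (rule differential_velocity[OF \<alpha> a])
  then show ?thesis using a[OF \<alpha> same_velocity_refl] by simp
qed

lemma D2_velocity:
  assumes \<beta>: "differentiable_curve_at M q \<beta>" and g: "g \<in> carrier G"
  shows "((\<lambda>t. L (g, \<beta> t)) has_real_derivative D2 M L g q (velocity M q \<beta>)) (at 0)"
proof (rule smooth_function_along_curves[OF manifold manifold smooth_L curve_const[OF g] \<beta>])
  fix b assume b: "\<And>\<delta>. differentiable_curve_at M q \<delta> \<Longrightarrow> same_velocity M q \<beta> \<delta> \<Longrightarrow>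
      ((\<lambda>t. L (g, \<delta> t)) has_real_derivative b) (at 0)"
  have "D2 M L g q (velocity M q \<beta>) = b"
    unfolding D2_def by (rule differential_velocity[OF \<beta> b])
  then show ?thesis using b[OF \<beta> same_velocity_refl] by simp
qed

lemma differential_reduced_velocity:
  assumes \<alpha>: "differentiable_curve_at M p \<alpha>"
  shows "((\<lambda>t. L (\<alpha> t, \<one>)) has_real_derivative differential M \<l> p (velocity M p \<alpha>)) (at 0)"
proof (rule smooth_function_along_curves[OF manifold manifold smooth_L \<alpha> curve_const[OF one_closed]])
  fix a assume a: "\<And>\<delta>. differentiable_curve_at M p \<delta> \<Longrightarrow> same_velocity M p \<alpha> \<delta> \<Longrightarrow>
      ((\<lambda>t. L (\<delta> t, \<one>)) has_real_derivative a) (at 0)"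
  have "differential M \<l> p (velocity M p \<alpha>) = a"
  proof (rule differential_velocity[OF \<alpha>])
    fix \<delta> assume \<delta>: "differentiable_curve_at M p \<delta>" "same_velocity M p \<alpha> \<delta>"
    have "\<forall>\<^sub>F t in nhds 0. \<l> (\<delta> t) = L (\<delta> t, \<one>)"
      using curve_in_carrier[OF \<delta>(1)] by eventually_elim (rule reduced_eq)
    then show "((\<lambda>t. \<l> (\<delta> t)) has_real_derivative a) (at 0)"
      by (rule has_real_derivative_eventually_eq[OF a[OF \<delta>]])
  qed
  then show ?thesis using a[OF \<alpha> same_velocity_refl] by simp
qed

text \<open>
  Invariance makes \<open>t \<mapsto> L(f c(t), c(t)) = L(f, e)\<close> constant, so moving the second argument by \<open>c\<close>
  is infinitesimally the opposite of moving the first argument by \<open>f c\<close>. This accounts for the sign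
  in the Euler-Poincare equations.
\<close>

lemma invariance_derivative:
  assumes c: "differentiable_curve_at M \<one> c" and f: "f \<in> carrier G"
    and a: "((\<lambda>t. L (f \<otimes> c t, \<one>)) has_real_derivative a) (at 0)"
    and b: "((\<lambda>t. L (f, c t)) has_real_derivative b) (at 0)"
  shows "a + b = 0"
proof -
  have fc: "differentiable_curve_at M f (\<lambda>t. f \<otimes> c t)"
    using curve_mult[OF curve_const[OF f] c] f by simp
  have "\<forall>\<^sub>F t in nhds 0. L (f \<otimes> c t, c t) = L (f, \<one>)"
    using curve_in_carrier[OF c]
  proof eventually_elim
    case (elim t)
    then show ?case using invariant[OF f one_closed elim] by simp
  qed
  then have const: "((\<lambda>t. L (f \<otimes> c t, c t)) has_real_derivative 0) (at 0)"
    by (rule has_real_derivative_eventually_eq[OF DERIV_const])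
  show ?thesis
  proof (rule smooth_function_along_curves[OF manifold manifold smooth_L fc c])
    fix a' b' assume ab: "((\<lambda>t. L (f \<otimes> c t, c t)) has_real_derivative a' + b') (at 0)"
      and a': "\<And>\<alpha>. differentiable_curve_at M f \<alpha> \<Longrightarrow> same_velocity M f (\<lambda>t. f \<otimes> c t) \<alpha> \<Longrightarrow>
        ((\<lambda>t. L (\<alpha> t, \<one>)) has_real_derivative a') (at 0)"
      and b': "\<And>\<beta>. differentiable_curve_at M \<one> \<beta> \<Longrightarrow> same_velocity M \<one> c \<beta> \<Longrightarrow>
        ((\<lambda>t. L (f, \<beta> t)) has_real_derivative b') (at 0)"
    from DERIV_unique[OF ab const] DERIV_unique[OF a a'[OF fc same_velocity_refl]]
      DERIV_unique[OF b b'[OF c same_velocity_refl]]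
    show ?thesis by simp
  qed
qed

text \<open>
  Here \<open>a, b, d\<close> are three consecutive points \<open>g\<^sub>k\<^sub>-\<^sub>1, g\<^sub>k, g\<^sub>k\<^sub>+\<^sub>1\<close>. The two sides agree term by term:
  \<open>D2\<close> with the term containing \<open>Ad\<close>, by \<open>invariance_derivative\<close>, and \<open>D1\<close> with the other one,
  because \<open>L(c b, d) = L(c f', e)\<close>.
\<close>

lemma DEL_eq_DEP:
  assumes c: "differentiable_curve_at M \<one> c"
    and G: "a \<in> carrier G" "b \<in> carrier G" "d \<in> carrier G"
    and f: "f = a \<otimes> inv b" and f': "f' = b \<otimes> inv d"
  shows "D2 M L a b (velocity M b (\<lambda>t. c t \<otimes> b)) + D1 M L b d (velocity M b (\<lambda>t. c t \<otimes> b))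
    = - differential M \<l> f (TR G M f (Ad G M f (velocity M \<one> c)))
      + differential M \<l> f' (TR G M f' (velocity M \<one> c))"
proof -
  have F: "f \<in> carrier G" "f' \<in> carrier G" using G f f' by auto
  have fb: "f \<otimes> b = a" and f'd: "f' \<otimes> d = b" using G by (simp_all add: f f' m_assoc)
  have cb: "differentiable_curve_at M b (\<lambda>t. c t \<otimes> b)"
    using curve_mult[OF c curve_const[OF G(2)]] G by simp
  have cf': "differentiable_curve_at M f' (\<lambda>t. c t \<otimes> f')"
    using curve_mult[OF c curve_const[OF F(2)]] F by simp
  have conj: "differentiable_curve_at M \<one> (\<lambda>t. f \<otimes> c t \<otimes> inv f)"
    using curve_mult[OF curve_mult[OF curve_const[OF F(1)] c] curve_const[OF inv_closed[OF F(1)]]] F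
    by simp
  have conjf: "differentiable_curve_at M f (\<lambda>t. f \<otimes> c t \<otimes> inv f \<otimes> f)"
    using curve_mult[OF conj curve_const[OF F(1)]] F by simp
  note ev = curve_in_carrier[OF c]

  \<comment> \<open>the term with \<open>Ad\<close>: it is compared with \<open>D2\<close> through \<open>L(f c, e)\<close> and \<open>L(f, c)\<close>\<close>
  have "\<forall>\<^sub>F t in nhds 0. L (f \<otimes> c t, \<one>) = L (f \<otimes> c t \<otimes> inv f \<otimes> f, \<one>)"
    using ev by eventually_elim (use F in \<open>simp add: m_assoc\<close>)
  then have "((\<lambda>t. L (f \<otimes> c t, \<one>)) has_real_derivative
      differential M \<l> f (TR G M f (Ad G M f (velocity M \<one> c)))) (at 0)"
    unfolding Ad_velocity[OF c F(1)] TR_velocity[OF conj F(1)]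
    by (rule has_real_derivative_eventually_eq[OF differential_reduced_velocity[OF conjf]])
  moreover have "\<forall>\<^sub>F t in nhds 0. L (f, c t) = L (a, c t \<otimes> b)"
    using ev by eventually_elim (use invariant[OF F(1) _ G(2)] fb in metis)
  then have "((\<lambda>t. L (f, c t)) has_real_derivative
      D2 M L a b (velocity M b (\<lambda>t. c t \<otimes> b))) (at 0)"
    by (rule has_real_derivative_eventually_eq[OF D2_velocity[OF cb G(1)]])
  ultimately have second: "differential M \<l> f (TR G M f (Ad G M f (velocity M \<one> c)))
      + D2 M L a b (velocity M b (\<lambda>t. c t \<otimes> b)) = 0"
    using invariance_derivative[OF c F(1)] by blast

  \<comment> \<open>the remaining terms agree by invariance under \<open>d\<close>, since \<open>f' d = b\<close>\<close>
  have "\<forall>\<^sub>F t in nhds 0. L (c t \<otimes> b, d) = L (c t \<otimes> f', \<one>)"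
    using ev
  proof eventually_elim
    case (elim t)
    then show ?case
      using invariant[of "c t \<otimes> f'" \<one> d] F G f'd by (simp add: m_assoc)
  qed
  then have "((\<lambda>t. L (c t \<otimes> b, d)) has_real_derivative
      differential M \<l> f' (TR G M f' (velocity M \<one> c))) (at 0)"
    unfolding TR_velocity[OF c F(2)]
    by (rule has_real_derivative_eventually_eq[OF differential_reduced_velocity[OF cf']])
  from DERIV_unique[OF D1_velocity[OF cb G(3)] this]
  have first: "D1 M L b d (velocity M b (\<lambda>t. c t \<otimes> b))
      = differential M \<l> f' (TR G M f' (velocity M \<one> c))" .
  show ?thesis using first second by simp
qed

text \<open>
  Right translation by \<open>b\<close> maps the tangent space at the identity onto the one at \<open>b\<close>, so the
  vectors compared in \<open>DEL_eq_DEP\<close> exhaust both spaces.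
\<close>

lemma DEL_iff_DEP_at:
  assumes G: "a \<in> carrier G" "b \<in> carrier G" "d \<in> carrier G"
    and f: "f = a \<otimes> inv b" and f': "f' = b \<otimes> inv d"
  shows "(\<forall>v\<in>tangent_space M b. D2 M L a b v + D1 M L b d v = 0) \<longleftrightarrow>
    (\<forall>\<theta>\<in>lie_algebra G M. - differential M \<l> f (TR G M f (Ad G M f \<theta>))
      + differential M \<l> f' (TR G M f' \<theta>) = 0)"
  (is "?DEL \<longleftrightarrow> ?DEP")
proof
  assume DEL: ?DEL
  show ?DEP
  proof
    fix \<theta> assume "\<theta> \<in> lie_algebra G M"
    then obtain c where c: "curve_at M \<one> c" "\<theta> = velocity M \<one> c"
      by (auto simp: tangent_space_def)
    have "differentiable_curve_at M b (\<lambda>t. c t \<otimes> b)"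
      using curve_mult[OF curve_at_differentiable[OF c(1)] curve_const[OF G(2)]] G by simp
    then show "- differential M \<l> f (TR G M f (Ad G M f \<theta>))
        + differential M \<l> f' (TR G M f' \<theta>) = 0"
      using DEL velocity_in_tangent_space DEL_eq_DEP[OF curve_at_differentiable[OF c(1)] G f f'] c(2)
      by metis
  qed
next
  assume DEP: ?DEP
  show ?DEL
  proof
    fix v assume "v \<in> tangent_space M b"
    then obtain \<gamma> where \<gamma>: "curve_at M b \<gamma>" "v = velocity M b \<gamma>"
      by (auto simp: tangent_space_def)
    note \<gamma>' = curve_at_differentiable[OF \<gamma>(1)]
    let ?c = "\<lambda>t. \<gamma> t \<otimes> inv b"
    have c: "differentiable_curve_at M \<one> ?c"
      using curve_mult[OF \<gamma>' curve_const[OF inv_closed[OF G(2)]]] G by simp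
    have "\<forall>\<^sub>F t in nhds 0. ?c t \<otimes> b = \<gamma> t"
      using curve_in_carrier[OF \<gamma>'] by eventually_elim (use G in \<open>simp add: m_assoc\<close>)
    then have "velocity M b (\<lambda>t. ?c t \<otimes> b) = v"
      unfolding \<gamma>(2) by (intro velocity_eq_if_same_velocity same_velocity_eventually_eq[OF \<gamma>'])
    then show "D2 M L a b v + D1 M L b d v = 0"
      using DEL_eq_DEP[OF c G f f'] DEP velocity_in_tangent_space[OF c] by metis
  qed
qed

end

context lie_group
begin

lemma reconstruct_closed:
  "(\<And>i. i < k \<Longrightarrow> f i \<in> carrier G) \<Longrightarrow> g0 \<in> carrier G \<Longrightarrow> reconstruct G f g0 k \<in> carrier G"
  by (induction k) auto

lemma reconstruct_projection:
  assumes "\<And>i. i \<le> k \<Longrightarrow> f i \<in> carrier G" and "g0 \<in> carrier G"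
  shows "f k = reconstruct G f g0 k \<otimes> inv (reconstruct G f g0 (Suc k))"
proof -
  have "reconstruct G f g0 k \<in> carrier G" "f k \<in> carrier G"
    using assms by (auto intro: reconstruct_closed)
  then show ?thesis by (simp add: inv_mult_group m_assoc[symmetric])
qed

end

theorem theorem2p3:
  fixes G :: "'a monoid"
    and M :: "('a, 'e::real_inner) manifold"
    and L :: "'a \<times> 'a \<Rightarrow> real"
    and \<l> :: "'a \<Rightarrow> real"
  assumes "lie_group G M"
    and "smooth_function (prod_manifold M M) L"
    and "\<And>g1 g2 h. g1 \<in> carrier G \<Longrightarrow> g2 \<in> carrier G \<Longrightarrow> h \<in> carrier G \<Longrightarrow>
           L (g1 \<otimes>\<^bsub>G\<^esub> h, g2 \<otimes>\<^bsub>G\<^esub> h) = L (g1, g2)"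
    and "\<And>g1 g2. g1 \<in> carrier G \<Longrightarrow> g2 \<in> carrier G \<Longrightarrow>
           \<l> (g1 \<otimes>\<^bsub>G\<^esub> inv\<^bsub>G\<^esub> g2) = L (g1, g2)"
  shows "(\<forall>N g. DEL_solution G M L N g \<longrightarrow>
           DEP_solution G M \<l> N (\<lambda>k. canonical_proj G (g k, g (k + 1)))) \<and>
         (\<forall>N f. DEP_solution G M \<l> N f \<longrightarrow>
           (\<forall>g0\<in>carrier G.
              DEL_solution G M L N (reconstruct G f g0) \<and>
              (\<forall>k. 0 < k \<and> k < N \<longrightarrow>
                 (reconstruct G f g0 k, reconstruct G f g0 (k + 1)) =
                 (inv\<^bsub>G\<^esub> (f (k - 1)) \<otimes>\<^bsub>G\<^esub> reconstruct G f g0 (k - 1),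
                  inv\<^bsub>G\<^esub> (f k) \<otimes>\<^bsub>G\<^esub> reconstruct G f g0 k))))"
proof -
  interpret invariant_lagrangian G M L \<l>
    by (intro invariant_lagrangian.intro invariant_lagrangian_axioms.intro) (rule assms; assumption)+
  show ?thesis
  proof (intro conjI allI impI ballI)
    fix N g assume DEL: "DEL_solution G M L N g"
    then have g: "\<And>k. k \<le> N \<Longrightarrow> g k \<in> carrier G" by (simp add: DEL_solution_def)
    let ?f = "\<lambda>k. canonical_proj G (g k, g (k + 1))"
    have "\<forall>\<theta>\<in>lie_algebra G M.
        - differential M \<l> (?f (k - 1)) (TR G M (?f (k - 1)) (Ad G M (?f (k - 1)) \<theta>))
        + differential M \<l> (?f k) (TR G M (?f k) \<theta>) = 0" if "0 < k" "k < N" for k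
    proof (rule iffD1[OF DEL_iff_DEP_at])
      show "g (k - 1) \<in> carrier G" "g k \<in> carrier G" "g (k + 1) \<in> carrier G"
        using g that by auto
      show "?f (k - 1) = g (k - 1) \<otimes>\<^bsub>G\<^esub> inv\<^bsub>G\<^esub> g k" "?f k = g k \<otimes>\<^bsub>G\<^esub> inv\<^bsub>G\<^esub> g (k + 1)"
        using that by (auto simp: canonical_proj_def)
      show "\<forall>v\<in>tangent_space M (g k). D2 M L (g (k - 1)) (g k) v + D1 M L (g k) (g (k + 1)) v = 0"
        using DEL that by (simp add: DEL_solution_def)
    qed
    moreover have "\<forall>k<N. ?f k \<in> carrier G" using g by (simp add: canonical_proj_def)
    ultimately show "DEP_solution G M \<l> N ?f" by (simp add: DEP_solution_def)
  next
    fix N f g0 assume DEP: "DEP_solution G M \<l> N f" and g0: "g0 \<in> carrier G"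
    then have f: "\<And>k. k < N \<Longrightarrow> f k \<in> carrier G" by (simp add: DEP_solution_def)
    let ?g = "reconstruct G f g0"
    have g: "?g k \<in> carrier G" if "k \<le> N" for k
      using f g0 that by (intro reconstruct_closed) auto
    have "\<forall>v\<in>tangent_space M (?g k). D2 M L (?g (k - 1)) (?g k) v + D1 M L (?g k) (?g (k + 1)) v = 0"
      if "0 < k" "k < N" for k
    proof (rule iffD2[OF DEL_iff_DEP_at])
      show "?g (k - 1) \<in> carrier G" "?g k \<in> carrier G" "?g (k + 1) \<in> carrier G"
        using that by (intro g, simp)+
      show "f (k - 1) = ?g (k - 1) \<otimes>\<^bsub>G\<^esub> inv\<^bsub>G\<^esub> ?g k" "f k = ?g k \<otimes>\<^bsub>G\<^esub> inv\<^bsub>G\<^esub> ?g (k + 1)"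
        using reconstruct_projection[OF _ g0, of "k - 1" f] reconstruct_projection[OF _ g0, of k f]
          f that by (metis Suc_eq_plus1 Suc_pred' le_less_trans less_imp_diff_less)+
      show "\<forall>\<theta>\<in>lie_algebra G M.
          - differential M \<l> (f (k - 1)) (TR G M (f (k - 1)) (Ad G M (f (k - 1)) \<theta>))
          + differential M \<l> (f k) (TR G M (f k) \<theta>) = 0"
        using DEP that by (simp add: DEP_solution_def)
    qed
    then show "DEL_solution G M L N ?g" using g unfolding DEL_solution_def by blast
    fix k assume "0 < k \<and> k < N"
    then show "(?g k, ?g (k + 1)) =
        (inv\<^bsub>G\<^esub> (f (k - 1)) \<otimes>\<^bsub>G\<^esub> ?g (k - 1), inv\<^bsub>G\<^esub> (f k) \<otimes>\<^bsub>G\<^esub> ?g k)"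
      by (cases k) auto
  qed
qed

end
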